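(* Suppose $f_{1k}\ge\max_{t\in[T]}\left(\frac{\sum_{\tau=1}^td_k(\tau)}{t}\right)$ for all $k\in\mathcal{N}_D$. There exists $h_{\min}\ge 0$ such that $P(h)$ and $\Pi^{\{1\}}(h)$ are feasible if and only if $h\ge h_{\min}$, where $$h_{\min}=\sum_{k\in\mathcal{N}_D}\max_{0\le t_1<t_2\le T}\left[\sum_{\tau=t_1+1}^{t_2}\left(d_k(\tau)-f_{1k}\right)\right]^+$$ (that is, each of the two problems is feasible exactly when $h\ge h_{\min}$). Also, $p_*$ and $\pi_*^{\{1\}}$ satisfy: (a) $p_*(h_{\min})=\pi_*^{\{1\}}(h_{\min})$; (b) there exists $h_{sat}\ge h_{\min}$ such that $p_*(h)=\pi_*^{\{1\}}(h)$ for all $h\ge h_{sat}$.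
   Context: Star network on $n\ge2$ buses: bus 1 is the only generation bus, $\mathcal{N}_D=\{2,\dots,n\}$ are load-only buses, and bus 1 is joined to each $k\in\mathcal{N}_D$ by a line of capacity $f_{1k}\ge 0$ (there are no other lines). The demand profiles $d_k(t)\ge0$, $k\in\mathcal{N}_D$, $t\in[T]=\{1,\dots,T\}$, are given; bus 1 has no demand and load buses have no generation. The generation capacity at bus 1 is infinite ($\overline{g}_1=\infty$). The generation cost $c_1:[0,\infty)\to[0,\infty)$ is nondecreasing and strictly convex. Storage is perfectly efficient and ramp constraints are ignored (charging/discharging efficiencies and ramp constants all equal to 1). $[x]^+=\max(x,0)$. Problem $P(h)$, with storage budget $h\ge 0$: minimize $\sum_{t=1}^Tc_1(g_1(t))$ over real $g_1(t)$, $r_k(t)$, $p_{1k}(t)$, $b_k$, subject to, for all $t\in[T]$: $g_1(t)\ge 0$; $g_1(t)-r_1(t)=\sum_{k\in\mathcal{N}_D}p_{1k}(t)$; for $k\in\mathcal{N}_D$, $p_{1k}(t)=d_k(t)+r_k(t)$ and $|p_{1k}(t)|\le f_{1k}$; and for $k=1,\dots,n$, $0\le s_k(t)\le b_k$ with $s_k(t)=\sum_{\tau=1}^tr_k(\tau)$, $s_k(T)=0$, $b_k\ge0$, and $\sum_{k=1}^nb_k\le h$. Here $r_k(t)$ is the net power flowing into the storage at bus $k$ and $b_k$ its capacity. Problem $\Pi^{\{1\}}(h)$ is the same problem with the additional constraint $b_1=0$. Their optimal values are $p_*(h)$ and $\pi_*^{\{1\}}(h)$. *)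

theory Defs
  imports "HOL-Analysis.Analysis"
begin

definition strictly_convex_on :: "real set \<Rightarrow> (real \<Rightarrow> real) \<Rightarrow> bool" where
  "strictly_convex_on S c \<longleftrightarrow> convex S \<and>
     (\<forall>x\<in>S. \<forall>y\<in>S. \<forall>u. x \<noteq> y \<and> 0 < u \<and> u < 1 \<longrightarrow>
        c ((1 - u) * x + u * y) < (1 - u) * c x + u * c y)"

(* Storage is perfectly efficient and initially empty. *)
definition storage_level :: "(nat \<Rightarrow> nat \<Rightarrow> real) \<Rightarrow> nat \<Rightarrow> nat \<Rightarrow> real" where
  "storage_level r k t = (\<Sum>\<tau>=1..t. r k \<tau>)"

(* Bus 1 is the generation bus and buses 2..n are the load buses. The line between bus 1 and
   load bus k is identified with k: f k is its capacity and p k t the power sent from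
   bus 1 to bus k at time t. Values at indices outside the network or the horizon are never used. *)
definition feasible_P ::
  "nat \<Rightarrow> nat \<Rightarrow> (nat \<Rightarrow> real) \<Rightarrow> (nat \<Rightarrow> nat \<Rightarrow> real) \<Rightarrow> real \<Rightarrow>
   (nat \<Rightarrow> real) \<Rightarrow> (nat \<Rightarrow> nat \<Rightarrow> real) \<Rightarrow> (nat \<Rightarrow> nat \<Rightarrow> real) \<Rightarrow> (nat \<Rightarrow> real) \<Rightarrow> bool" where
  "feasible_P n T f d h g r p b \<longleftrightarrow>
     (\<forall>t\<in>{1..T}.
        0 \<le> g t \<and>
        g t - r 1 t = (\<Sum>k=2..n. p k t) \<and>
        (\<forall>k\<in>{2..n}. p k t = d k t + r k t \<and> \<bar>p k t\<bar> \<le> f k) \<and>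
        (\<forall>k\<in>{1..n}. 0 \<le> storage_level r k t \<and> storage_level r k t \<le> b k)) \<and>
     (\<forall>k\<in>{1..n}. storage_level r k T = 0 \<and> 0 \<le> b k) \<and>
     (\<Sum>k=1..n. b k) \<le> h"

definition feasible_Pi ::
  "nat \<Rightarrow> nat \<Rightarrow> (nat \<Rightarrow> real) \<Rightarrow> (nat \<Rightarrow> nat \<Rightarrow> real) \<Rightarrow> real \<Rightarrow>
   (nat \<Rightarrow> real) \<Rightarrow> (nat \<Rightarrow> nat \<Rightarrow> real) \<Rightarrow> (nat \<Rightarrow> nat \<Rightarrow> real) \<Rightarrow> (nat \<Rightarrow> real) \<Rightarrow> bool" where
  "feasible_Pi n T f d h g r p b \<longleftrightarrow> feasible_P n T f d h g r p b \<and> b 1 = 0"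

definition P_feasible :: "nat \<Rightarrow> nat \<Rightarrow> (nat \<Rightarrow> real) \<Rightarrow> (nat \<Rightarrow> nat \<Rightarrow> real) \<Rightarrow> real \<Rightarrow> bool" where
  "P_feasible n T f d h \<longleftrightarrow> (\<exists>g r p b. feasible_P n T f d h g r p b)"

definition Pi_feasible :: "nat \<Rightarrow> nat \<Rightarrow> (nat \<Rightarrow> real) \<Rightarrow> (nat \<Rightarrow> nat \<Rightarrow> real) \<Rightarrow> real \<Rightarrow> bool" where
  "Pi_feasible n T f d h \<longleftrightarrow> (\<exists>g r p b. feasible_Pi n T f d h g r p b)"

definition cost :: "nat \<Rightarrow> (real \<Rightarrow> real) \<Rightarrow> (nat \<Rightarrow> real) \<Rightarrow> real" where
  "cost T c g = (\<Sum>t=1..T. c (g t))"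

(* Extended reals, so that an infeasible problem has optimal value \<infinity>. *)
definition p_opt ::
  "nat \<Rightarrow> nat \<Rightarrow> (nat \<Rightarrow> real) \<Rightarrow> (nat \<Rightarrow> nat \<Rightarrow> real) \<Rightarrow> (real \<Rightarrow> real) \<Rightarrow> real \<Rightarrow> ereal" where
  "p_opt n T f d c h = Inf {ereal (cost T c g) | g r p b. feasible_P n T f d h g r p b}"

definition pi_opt ::
  "nat \<Rightarrow> nat \<Rightarrow> (nat \<Rightarrow> real) \<Rightarrow> (nat \<Rightarrow> nat \<Rightarrow> real) \<Rightarrow> (real \<Rightarrow> real) \<Rightarrow> real \<Rightarrow> ereal" where
  "pi_opt n T f d c h = Inf {ereal (cost T c g) | g r p b. feasible_Pi n T f d h g r p b}"

end

(* Each load bus k has a pointwise least storage trajectory compatible with its line limit: the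
   worst excess of future demand over line capacity. It starts empty because the mean demand up to
   any time is at most f k, and its peak is the k-th summand of h_min. This settles feasibility;
   at h = h_min the load storages use up the whole budget, which forces b 1 = 0.

   For a large budget, let M k be the cumulative supply of bus k along its least trajectory. Every
   solution of P(h) generates cumulatively at least the sum of the M k. Among the
   schedules without storage at bus 1, take one minimizing the sum of the squared total
   generations. Moving supply of one bus between two periods shows that its total generation is
   nonincreasing in time, and drops only at times where every bus is at M k. By subgradients of c
   and Abel summation such a profile costs no more than any profile feasible in P(h). *)
theory Submission
  imports Defs
begin

section \<open>Least storage trajectory and least capacity of a single load bus\<close>

lemma sum_diff_telescope:
  fixes F :: "nat \<Rightarrow> real"
  shows "(\<Sum>\<tau>=1..t. F \<tau> - F (\<tau> - 1)) = F t - F 0"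
  by (induction t) auto

text \<open>The least energy that the storage of a load bus with demand d behind a line of capacity f
  must hold at the end of period t in order to survive every later run of excess demand. The
  choice u = t contributes the empty sum 0.\<close>

definition min_level :: "nat \<Rightarrow> real \<Rightarrow> (nat \<Rightarrow> real) \<Rightarrow> nat \<Rightarrow> real" where
  "min_level T f d t = (MAX u\<in>{t..T}. \<Sum>\<tau>=t+1..u. d \<tau> - f)"

lemma min_level_ge:
  assumes "t \<le> u" "u \<le> T"
  shows "(\<Sum>\<tau>=t+1..u. d \<tau> - f) \<le> min_level T f d t"
  unfolding min_level_def using assms by (intro Max_ge) auto

lemma min_level_le:
  assumes "t \<le> T" "\<And>u. t \<le> u \<Longrightarrow> u \<le> T \<Longrightarrow> (\<Sum>\<tau>=t+1..u. d \<tau> - f) \<le> z"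
  shows "min_level T f d t \<le> z"
  unfolding min_level_def using assms by (subst Max_le_iff) auto

lemma min_level_nonneg: "t \<le> T \<Longrightarrow> 0 \<le> min_level T f d t"
  using min_level_ge[of t t T] by simp

lemma min_level_final: "min_level T f d T = 0"
  by (simp add: min_level_def)

text \<open>The bound on mean demand enters here: no run beginning with period 1 has positive total
  excess, so the least trajectory can start from an empty storage.\<close>

lemma min_level_initial:
  assumes "\<And>t. t \<in> {1..T} \<Longrightarrow> (\<Sum>\<tau>=1..t. d \<tau>) \<le> real t * f"
  shows "min_level T f d 0 = 0"
proof (rule antisym)
  show "min_level T f d 0 \<le> 0"
  proof (rule min_level_le)
    fix u assume "u \<le> T"
    then show "(\<Sum>\<tau>=0+1..u. d \<tau> - f) \<le> 0"
      using assms[of u] by (cases u) (simp_all add: sum_subtractf)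
  qed simp
qed (simp add: min_level_nonneg)

text \<open>A run starting after \<open>t\<close> extends backwards by period \<open>t\<close>,
  which adds \<open>d t - f\<close> to its excess. Hence following the least trajectory never
  overloads the line.\<close>

lemma min_level_step_le:
  assumes "t \<in> {1..T}"
  shows "d t + min_level T f d t - min_level T f d (t - 1) \<le> f"
proof -
  have "min_level T f d t \<le> min_level T f d (t - 1) + f - d t"
  proof (rule min_level_le)
    fix u assume "t \<le> u" "u \<le> T"
    then have "t - 1 \<le> u" by simp
    have "(\<Sum>\<tau>=t-1+1..u. d \<tau> - f) = (d t - f) + (\<Sum>\<tau>=t+1..u. d \<tau> - f)"
      using assms \<open>t \<le> u\<close> by (simp add: sum.atLeast_Suc_atMost)
    then show "(\<Sum>\<tau>=t+1..u. d \<tau> - f) \<le> min_level T f d (t - 1) + f - d t"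
      using min_level_ge[OF \<open>t - 1 \<le> u\<close> \<open>u \<le> T\<close>, of d f] by simp
  qed (use assms in auto)
  then show ?thesis by simp
qed

text \<open>A run that may start with period \<open>t\<close> is either empty or begins with an
  excess of at most \<open>d t\<close>. Hence following the least trajectory never sends power back
  to bus 1.\<close>

lemma min_level_step_ge:
  assumes "t \<in> {1..T}" "0 \<le> f" "0 \<le> d t"
  shows "0 \<le> d t + min_level T f d t - min_level T f d (t - 1)"
proof -
  have "min_level T f d (t - 1) \<le> d t + min_level T f d t"
  proof (rule min_level_le)
    fix u assume u: "t - 1 \<le> u" "u \<le> T"
    show "(\<Sum>\<tau>=t-1+1..u. d \<tau> - f) \<le> d t + min_level T f d t"
    proof (cases "t \<le> u")
      case True
      then have "(\<Sum>\<tau>=t-1+1..u. d \<tau> - f) = (d t - f) + (\<Sum>\<tau>=t+1..u. d \<tau> - f)"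
        using assms by (simp add: sum.atLeast_Suc_atMost)
      then show ?thesis
        using min_level_ge[of t u T d f] True u assms by simp
    next
      case False
      then show ?thesis
        using assms min_level_nonneg[of t T f d] by simp
    qed
  qed (use assms in auto)
  then show ?thesis by simp
qed

text \<open>From \<open>t + 1\<close> to \<open>u\<close> the excess demand has to be met by
  discharging, and the level at \<open>u\<close> must still be nonnegative.\<close>

lemma min_level_le_storage:
  fixes r d :: "nat \<Rightarrow> real"
  assumes "t \<le> T"
    and "\<And>u. u \<le> T \<Longrightarrow> 0 \<le> (\<Sum>\<tau>=1..u. r \<tau>)"
    and "\<And>\<tau>. \<tau> \<in> {1..T} \<Longrightarrow> d \<tau> + r \<tau> \<le> f"
  shows "min_level T f d t \<le> (\<Sum>\<tau>=1..t. r \<tau>)"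
proof (rule min_level_le)
  fix u assume u: "t \<le> u" "u \<le> T"
  have "(\<Sum>\<tau>=t+1..u. d \<tau> - f) \<le> (\<Sum>\<tau>=t+1..u. - r \<tau>)"
    using u assms(3) by (intro sum_mono) (force simp: algebra_simps)
  also have "\<dots> = (\<Sum>\<tau>=1..t. r \<tau>) - (\<Sum>\<tau>=1..u. r \<tau>)"
    using sum.ub_add_nat[of 1 t r "u - t"] u by (simp add: sum_negf)
  finally show "(\<Sum>\<tau>=t+1..u. d \<tau> - f) \<le> (\<Sum>\<tau>=1..t. r \<tau>)"
    using assms(2)[of u] u by simp
qed (use assms in simp)

text \<open>For \<open>1 \<le> T\<close> this is the peak of \<open>min_level\<close> over
  \<open>t \<le> T\<close>; the two bounds are \<open>min_level_le_min_capacity\<close> and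
  \<open>min_capacity_le\<close>.\<close>

definition min_capacity :: "nat \<Rightarrow> real \<Rightarrow> (nat \<Rightarrow> real) \<Rightarrow> real" where
  "min_capacity T f d =
     Max {max (\<Sum>\<tau>=t\<^sub>1+1..t\<^sub>2. d \<tau> - f) 0 | t\<^sub>1 t\<^sub>2. t\<^sub>1 < t\<^sub>2 \<and> t\<^sub>2 \<le> T}"

lemma finite_excess_set:
  "finite {max (\<Sum>\<tau>=t\<^sub>1+1..t\<^sub>2. d \<tau> - f) (0::real) | t\<^sub>1 t\<^sub>2. t\<^sub>1 < t\<^sub>2 \<and> t\<^sub>2 \<le> (T::nat)}"
  by (rule finite_subset[of _ "(\<lambda>(t\<^sub>1, t\<^sub>2). max (\<Sum>\<tau>=t\<^sub>1+1..t\<^sub>2. d \<tau> - f) 0) ` ({..T} \<times> {..T})"])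
    force+

lemma min_capacity_ge:
  assumes "t\<^sub>1 < t\<^sub>2" "t\<^sub>2 \<le> T"
  shows "max (\<Sum>\<tau>=t\<^sub>1+1..t\<^sub>2. d \<tau> - f) 0 \<le> min_capacity T f d"
  unfolding min_capacity_def using assms by (intro Max_ge[OF finite_excess_set]) blast

lemma min_capacity_nonneg: "1 \<le> T \<Longrightarrow> 0 \<le> min_capacity T f d"
  using min_capacity_ge[of 0 1 T d f] by simp

lemma min_level_le_min_capacity:
  assumes "t \<le> T" "1 \<le> T"
  shows "min_level T f d t \<le> min_capacity T f d"
proof (rule min_level_le)
  fix u assume "t \<le> u" "u \<le> T"
  then show "(\<Sum>\<tau>=t+1..u. d \<tau> - f) \<le> min_capacity T f d"
    using min_capacity_ge[of t u T d f] min_capacity_nonneg[OF assms(2)]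
    by (cases "t = u") auto
qed (fact assms)

lemma min_capacity_le:
  assumes "1 \<le> T" "0 \<le> z" "\<And>t. t \<le> T \<Longrightarrow> min_level T f d t \<le> z"
  shows "min_capacity T f d \<le> z"
proof -
  have "max (\<Sum>\<tau>=t\<^sub>1+1..t\<^sub>2. d \<tau> - f) 0 \<le> z" if "t\<^sub>1 < t\<^sub>2" "t\<^sub>2 \<le> T" for t\<^sub>1 t\<^sub>2
    using min_level_ge[of t\<^sub>1 t\<^sub>2 T d f] assms(2) assms(3)[of t\<^sub>1] that by simp
  moreover have "max (\<Sum>\<tau>=0+1..1. d \<tau> - f) 0
      \<in> {max (\<Sum>\<tau>=t\<^sub>1+1..t\<^sub>2. d \<tau> - f) 0 | t\<^sub>1 t\<^sub>2. t\<^sub>1 < t\<^sub>2 \<and> t\<^sub>2 \<le> T}"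
    using assms(1) by force
  ultimately show ?thesis
    unfolding min_capacity_def by (subst Max_le_iff[OF finite_excess_set]) blast+
qed

section \<open>Cost comparison by subgradients and Abel summation\<close>

text \<open>At the boundary point 0 convexity alone may leave no finite subgradient, but
  monotonicity makes slope 0 work. All other points are interior.\<close>

lemma convex_nonneg_subgradient:
  fixes c :: "real \<Rightarrow> real"
  assumes "convex_on {0..} c" "mono_on {0..} c" "0 \<le> x"
  shows "\<exists>\<gamma>. \<forall>y\<ge>0. c x + \<gamma> * (y - x) \<le> c y"
proof (cases "x = 0")
  case True
  then show ?thesis
    using assms(2) by (intro exI[of _ 0]) (auto simp: mono_on_def)
next
  case False
  then have "x \<in> interior {0..}"
    using assms(3) by (auto simp: interior_real_atLeast)
  then show ?thesis
    using convex_le_Inf_differential[OF assms(1)] by fastforce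
qed

lemma subgradient_mono:
  fixes c :: "real \<Rightarrow> real"
  assumes "x < x'" "c x + \<gamma> * (x' - x) \<le> c x'" "c x' + \<gamma>' * (x - x') \<le> c x"
  shows "\<gamma> \<le> \<gamma>'"
proof -
  have "(\<gamma> - \<gamma>') * (x' - x) \<le> 0"
    using assms(2,3) by (simp add: algebra_simps)
  then show ?thesis
    using assms(1) by (auto simp: mult_le_0_iff)
qed

text \<open>Abel summation with the boundary term kept on the left.\<close>

lemma weighted_sum_ge_last:
  fixes w e :: "nat \<Rightarrow> real"
  assumes "1 \<le> m"
    and "\<And>j. 1 \<le> j \<Longrightarrow> j < m \<Longrightarrow> 0 \<le> (w j - w (Suc j)) * (\<Sum>\<tau>=1..j. e \<tau>)"
  shows "w m * (\<Sum>\<tau>=1..m. e \<tau>) \<le> (\<Sum>\<tau>=1..m. w \<tau> * e \<tau>)"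
  using assms
proof (induction m rule: nat_induct_at_least)
  case (Suc m)
  then have "w m * (\<Sum>\<tau>=1..m. e \<tau>) \<le> (\<Sum>\<tau>=1..m. w \<tau> * e \<tau>)" by simp
  moreover have "0 \<le> (w m - w (Suc m)) * (\<Sum>\<tau>=1..m. e \<tau>)" using Suc by simp
  ultimately show ?case by (simp add: algebra_simps)
qed simp

text \<open>By subgradients the cost difference is at least a weighted sum of \<open>g' - g\<close>.
  Abel summation turns it into changes of slope times differences of partial sums, plus a boundary
  term that \<open>total\<close> makes zero. Slopes change only where \<open>g\<close> drops, and
  there \<open>tight\<close> fixes the sign.\<close>

lemma front_loaded_cost_le:
  fixes c :: "real \<Rightarrow> real" and g g' :: "nat \<Rightarrow> real"
  assumes "1 \<le> T" "convex_on {0..} c" "mono_on {0..} c"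
    and nonneg: "\<And>t. t \<in> {1..T} \<Longrightarrow> 0 \<le> g t" "\<And>t. t \<in> {1..T} \<Longrightarrow> 0 \<le> g' t"
    and decr: "\<And>t. 1 \<le> t \<Longrightarrow> t < T \<Longrightarrow> g (Suc t) \<le> g t"
    and tight: "\<And>t. 1 \<le> t \<Longrightarrow> t < T \<Longrightarrow> g (Suc t) < g t \<Longrightarrow>
                  (\<Sum>\<tau>=1..t. g \<tau>) \<le> (\<Sum>\<tau>=1..t. g' \<tau>)"
    and total: "(\<Sum>\<tau>=1..T. g \<tau>) = (\<Sum>\<tau>=1..T. g' \<tau>)"
  shows "(\<Sum>t=1..T. c (g t)) \<le> (\<Sum>t=1..T. c (g' t))"
proof -
  \<comment> \<open>\<open>\<gamma>\<close> depends only on the generation value, so equal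
    consecutive values of \<open>g\<close> get equal slopes and contribute nothing to the Abel
    sum.\<close>
  obtain \<gamma> where \<gamma>: "\<And>x y. 0 \<le> x \<Longrightarrow> 0 \<le> y \<Longrightarrow> c x + \<gamma> x * (y - x) \<le> c y"
    using convex_nonneg_subgradient[OF assms(2,3)] by metis
  have "\<gamma> (g T) * (\<Sum>\<tau>=1..T. g' \<tau> - g \<tau>) \<le> (\<Sum>\<tau>=1..T. \<gamma> (g \<tau>) * (g' \<tau> - g \<tau>))"
  proof (rule weighted_sum_ge_last[OF assms(1)])
    fix j assume j: "1 \<le> j" "j < T"
    show "0 \<le> (\<gamma> (g j) - \<gamma> (g (Suc j))) * (\<Sum>\<tau>=1..j. g' \<tau> - g \<tau>)"
    proof (cases "g (Suc j) < g j")
      case True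
      have "\<gamma> (g (Suc j)) \<le> \<gamma> (g j)"
        by (rule subgradient_mono[where c = c, OF True]) (use \<gamma> nonneg(1) j in auto)
      then show ?thesis
        using tight[OF j True] by (simp add: sum_subtractf)
    next
      case False
      then show ?thesis using decr[OF j] by simp
    qed
  qed
  then have "0 \<le> (\<Sum>\<tau>=1..T. \<gamma> (g \<tau>) * (g' \<tau> - g \<tau>))"
    using total by (simp add: sum_subtractf)
  moreover have "(\<Sum>t=1..T. c (g t) + \<gamma> (g t) * (g' t - g t)) \<le> (\<Sum>t=1..T. c (g' t))"
    by (intro sum_mono \<gamma> nonneg)
  ultimately show ?thesis by (simp add: sum.distrib)
qed

section \<open>Schedules minimizing the sum of squared generations\<close>

text \<open>Tychonoff's theorem in the topology of the function type; two nested uses make boxes of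
  schedules \<open>x k t\<close> compact.\<close>

lemma compact_PiE_UNIV:
  fixes S :: "'i \<Rightarrow> 'a::topological_space set"
  assumes "\<And>i. compact (S i)"
  shows "compact (PiE UNIV S)"
  using assms compactin_PiE[of "\<lambda>_. euclidean" UNIV S]
  by (simp add: euclidean_product_topology)

text \<open>Only the flows into the load buses are recorded: with no storage at bus 1 they determine
  the generation and, given the demand, all storage levels.\<close>

definition schedules ::
  "'k set \<Rightarrow> nat \<Rightarrow> ('k \<Rightarrow> real) \<Rightarrow> ('k \<Rightarrow> nat \<Rightarrow> real) \<Rightarrow> ('k \<Rightarrow> nat \<Rightarrow> real) set" where
  "schedules K T f M = {x. \<forall>k\<in>K.
     (\<forall>t\<in>{1..T}. 0 \<le> x k t \<and> x k t \<le> f k \<and> M k t \<le> (\<Sum>\<tau>=1..t. x k \<tau>)) \<and>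
     (\<Sum>\<tau>=1..T. x k \<tau>) = M k T}"

lemma schedules_attain_min_square:
  assumes "x0 \<in> schedules K T f M"
  shows "\<exists>x\<in>schedules K T f M. \<forall>y\<in>schedules K T f M.
           (\<Sum>t=1..T. (\<Sum>k\<in>K. x k t)\<^sup>2) \<le> (\<Sum>t=1..T. (\<Sum>k\<in>K. y k t)\<^sup>2)"
proof -
  define B where "B = (\<lambda>k. PiE UNIV (\<lambda>t. {0..if k \<in> K \<and> t \<in> {1..T} then f k else 0}))"
  define C where "C = PiE UNIV B \<inter> schedules K T f M"
  \<comment> \<open>Entries outside the index range are unconstrained; R cuts them off to gain compactness.\<close>
  define R where "R = (\<lambda>x k t. if k \<in> K \<and> t \<in> {1..T} then x k t else 0 :: real)"
  have R: "R x \<in> C" if "x \<in> schedules K T f M" for x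
  proof -
    have "(\<Sum>\<tau>=1..t. R x k \<tau>) = (\<Sum>\<tau>=1..t. x k \<tau>)" if "k \<in> K" "t \<le> T" for k t
      using that by (intro sum.cong) (auto simp: R_def)
    then show ?thesis
      using that by (fastforce simp: C_def B_def R_def schedules_def)
  qed
  have coord: "continuous_on S (\<lambda>x. x k t)" for S :: "('a \<Rightarrow> nat \<Rightarrow> real) set" and k t
    by (intro continuous_on_product_then_coordinatewise[of S "\<lambda>x. x k"]
          continuous_on_product_coordinates continuous_on_subset[OF _ subset_UNIV])
  have "compact (PiE UNIV B)"
    unfolding B_def by (intro compact_PiE_UNIV compact_Icc)
  moreover have "closed (schedules K T f M)"
    unfolding schedules_def Ball_def
    by (intro closed_Collect_all closed_Collect_imp closed_Collect_conj closed_Collect_le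
          closed_Collect_eq continuous_intros coord open_Collect_const)
  ultimately have "compact C"
    unfolding C_def by (rule compact_Int_closed)
  moreover have "continuous_on C (\<lambda>x. \<Sum>t=1..T. (\<Sum>k\<in>K. x k t)\<^sup>2)"
    by (intro continuous_intros coord)
  ultimately obtain x where x: "x \<in> C"
    "\<And>y. y \<in> C \<Longrightarrow> (\<Sum>t=1..T. (\<Sum>k\<in>K. x k t)\<^sup>2) \<le> (\<Sum>t=1..T. (\<Sum>k\<in>K. y k t)\<^sup>2)"
    using continuous_attains_inf[of C] R[OF assms] by blast
  have "(\<Sum>t=1..T. (\<Sum>k\<in>K. R y k t)\<^sup>2) = (\<Sum>t=1..T. (\<Sum>k\<in>K. y k t)\<^sup>2)" for y
    by (simp add: R_def)
  then show ?thesis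
    using x R by (metis C_def IntD2)
qed

text \<open>Shifting \<open>\<epsilon>\<close> of the supply of bus \<open>k\<close> from
  \<open>u\<close> to \<open>v\<close> changes the objective by
  \<open>2 * \<epsilon> * (g v - g u + \<epsilon>)\<close>, negative for small
  \<open>\<epsilon>\<close> if \<open>g v < g u\<close>. For \<open>v < u\<close> the premise
  \<open>slack\<close> is vacuous, since moving supply earlier only raises cumulative
  supply.\<close>

lemma min_square_exchange:
  fixes K :: "'k set" and x :: "'k \<Rightarrow> nat \<Rightarrow> real"
  defines "g \<equiv> \<lambda>t. \<Sum>k\<in>K. x k t"
  assumes "finite K"
    and x: "x \<in> schedules K T f M"
    and min: "\<And>y. y \<in> schedules K T f M \<Longrightarrow>
                (\<Sum>t=1..T. (g t)\<^sup>2) \<le> (\<Sum>t=1..T. (\<Sum>k\<in>K. y k t)\<^sup>2)"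
    and k: "k \<in> K" and uv: "u \<in> {1..T}" "v \<in> {1..T}" "u \<noteq> v"
    and room: "0 < x k u" "x k v < f k"
    and slack: "\<And>s. u \<le> s \<Longrightarrow> s < v \<Longrightarrow> M k s < (\<Sum>\<tau>=1..s. x k \<tau>)"
  shows "g u \<le> g v"
proof (rule ccontr)
  assume gt: "\<not> g u \<le> g v"
  \<comment> \<open>These are the limits on the shift: the flow at \<open>u\<close> stays
    nonnegative, the flow at \<open>v\<close> stays within the line, cumulative supply in between
    stays above \<open>M k\<close>, and half the gap keeps \<open>g v - g u + \<epsilon>\<close>
    negative.\<close>
  define A where "A = insert (x k u) (insert (f k - x k v) (insert ((g u - g v) / 2)
                    ((\<lambda>s. (\<Sum>\<tau>=1..s. x k \<tau>) - M k s) ` {u..<v})))"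
  define \<epsilon> where "\<epsilon> = Min A"
  have "finite A" "A \<noteq> {}" by (auto simp: A_def)
  moreover have "\<forall>a\<in>A. 0 < a" using room slack gt by (auto simp: A_def)
  ultimately have pos: "0 < \<epsilon>" by (simp add: \<epsilon>_def)
  have le: "\<epsilon> \<le> a" if "a \<in> A" for a
    using \<open>finite A\<close> that by (simp add: \<epsilon>_def)
  have \<epsilon>: "\<epsilon> \<le> x k u" "\<epsilon> \<le> f k - x k v" "\<epsilon> \<le> (g u - g v) / 2"
    and \<epsilon>_slack: "\<And>s. u \<le> s \<Longrightarrow> s < v \<Longrightarrow> \<epsilon> \<le> (\<Sum>\<tau>=1..s. x k \<tau>) - M k s"
    by (rule le; simp add: A_def)+
  define \<delta> where "\<delta> = (\<lambda>t. (if t = v then \<epsilon> else 0) - (if t = u then \<epsilon> else 0))"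
  define y where "y = (\<lambda>j t. x j t + (if j = k then \<delta> t else 0))"
  have cum: "(\<Sum>\<tau>=1..t. y k \<tau>) =
      (\<Sum>\<tau>=1..t. x k \<tau>) + (if v \<le> t then \<epsilon> else 0) - (if u \<le> t then \<epsilon> else 0)" for t
    using uv by (simp add: y_def \<delta>_def sum.distrib sum_subtractf)
  have "y \<in> schedules K T f M"
    unfolding schedules_def
  proof (intro CollectI ballI conjI)
    fix j t assume j: "j \<in> K" and t: "t \<in> {1..T}"
    have xj: "0 \<le> x j t" "x j t \<le> f j" "M j t \<le> (\<Sum>\<tau>=1..t. x j \<tau>)"
      using x j t by (auto simp: schedules_def)
    show "0 \<le> y j t" "y j t \<le> f j"
      using xj \<epsilon> pos uv by (auto simp: y_def \<delta>_def)
    show "M j t \<le> (\<Sum>\<tau>=1..t. y j \<tau>)"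
    proof (cases "j = k")
      case True
      then show ?thesis
        using cum[of t] xj pos \<epsilon>_slack[of t] by (auto split: if_splits)
    next
      case False
      then show ?thesis using xj by (simp add: y_def)
    qed
  next
    fix j assume j: "j \<in> K"
    then have "(\<Sum>\<tau>=1..T. x j \<tau>) = M j T" using x by (simp add: schedules_def)
    then show "(\<Sum>\<tau>=1..T. y j \<tau>) = M j T"
      using cum[of T] uv by (cases "j = k") (simp_all add: y_def)
  qed
  then have "(\<Sum>t=1..T. (g t)\<^sup>2) \<le> (\<Sum>t=1..T. (\<Sum>j\<in>K. y j t)\<^sup>2)" by (rule min)
  also have "\<dots> = (\<Sum>t=1..T. (g t)\<^sup>2 + (if t = v then 2 * g t * \<epsilon> + \<epsilon>\<^sup>2 else 0)
                   + (if t = u then \<epsilon>\<^sup>2 - 2 * g t * \<epsilon> else 0))"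
  proof (rule sum.cong[OF refl])
    fix t
    have eq: "(\<Sum>j\<in>K. y j t) = g t + \<delta> t"
      using \<open>finite K\<close> k by (simp add: y_def g_def sum.distrib)
    show "(\<Sum>j\<in>K. y j t)\<^sup>2 = (g t)\<^sup>2 + (if t = v then 2 * g t * \<epsilon> + \<epsilon>\<^sup>2 else 0)
                   + (if t = u then \<epsilon>\<^sup>2 - 2 * g t * \<epsilon> else 0)"
      unfolding eq using uv by (auto simp: \<delta>_def power2_eq_square algebra_simps)
  qed
  also have "\<dots> = (\<Sum>t=1..T. (g t)\<^sup>2) + (2 * g v * \<epsilon> + \<epsilon>\<^sup>2) + (\<epsilon>\<^sup>2 - 2 * g u * \<epsilon>)"
    using uv by (simp add: sum.distrib)
  finally have "0 \<le> 2 * \<epsilon> * (g v - g u + \<epsilon>)"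
    by (simp add: algebra_simps power2_eq_square)
  then have "0 \<le> g v - g u + \<epsilon>"
    using pos by (simp add: zero_le_mult_iff)
  then show False using \<epsilon>(3) gt by simp
qed

text \<open>A minimizer of the squares has both properties: a rise in generation could be improved
  by moving supply earlier, and a drop with some bus above \<open>M k\<close> by moving its supply
  later.\<close>

lemma front_loaded_schedule_exists:
  fixes f :: "'k \<Rightarrow> real" and M :: "'k \<Rightarrow> nat \<Rightarrow> real"
  assumes "finite K"
    and M0: "\<And>k. k \<in> K \<Longrightarrow> M k 0 = 0"
    and step: "\<And>k t. k \<in> K \<Longrightarrow> t \<in> {1..T} \<Longrightarrow> 0 \<le> M k t - M k (t - 1)"
              "\<And>k t. k \<in> K \<Longrightarrow> t \<in> {1..T} \<Longrightarrow> M k t - M k (t - 1) \<le> f k"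
  shows "\<exists>x\<in>schedules K T f M. \<forall>t. 1 \<le> t \<longrightarrow> t < T \<longrightarrow>
           (\<Sum>k\<in>K. x k (Suc t)) \<le> (\<Sum>k\<in>K. x k t) \<and>
           ((\<Sum>k\<in>K. x k (Suc t)) < (\<Sum>k\<in>K. x k t) \<longrightarrow>
             (\<forall>k\<in>K. (\<Sum>\<tau>=1..t. x k \<tau>) = M k t))"
proof -
  \<comment> \<open>The set of schedules is nonempty: the increments of \<open>M\<close> form
    one.\<close>
  have "(\<lambda>k t. M k t - M k (t - 1)) \<in> schedules K T f M"
    unfolding schedules_def using step M0 sum_diff_telescope[of "M _"] by simp
  then obtain x where x: "x \<in> schedules K T f M"
    and min: "\<And>y. y \<in> schedules K T f M \<Longrightarrow>
           (\<Sum>t=1..T. (\<Sum>k\<in>K. x k t)\<^sup>2) \<le> (\<Sum>t=1..T. (\<Sum>k\<in>K. y k t)\<^sup>2)"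
    using schedules_attain_min_square by blast
  define g where "g = (\<lambda>t. \<Sum>k\<in>K. x k t)"
  have bounds: "0 \<le> x k t" "x k t \<le> f k" "M k t \<le> (\<Sum>\<tau>=1..t. x k \<tau>)"
    if "k \<in> K" "t \<in> {1..T}" for k t
    using x that by (auto simp: schedules_def)
  have total: "(\<Sum>\<tau>=1..T. x k \<tau>) = M k T" if "k \<in> K" for k
    using x that by (simp add: schedules_def)
  have exchange: "g u \<le> g v"
    if "k \<in> K" "u \<in> {1..T}" "v \<in> {1..T}" "u \<noteq> v" "0 < x k u" "x k v < f k"
      "\<And>s. u \<le> s \<Longrightarrow> s < v \<Longrightarrow> M k s < (\<Sum>\<tau>=1..s. x k \<tau>)" for k u v
    unfolding g_def by (rule min_square_exchange[OF assms(1) x min]) (use that in auto)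
  have decr: "g v \<le> g u" if "u \<in> {1..T}" "v \<in> {1..T}" "u \<le> v" for u v
  proof (rule ccontr)
    assume gt: "\<not> g v \<le> g u"
    \<comment> \<open>Some bus gets more at \<open>v\<close> than at \<open>u\<close>, so it has
      supply to give up at \<open>v\<close> and room on its line at \<open>u\<close>; a shift to the
      earlier time needs no slack.\<close>
    then obtain k where k: "k \<in> K" "x k u < x k v"
      unfolding g_def using sum_mono[of K "\<lambda>k. x k v" "\<lambda>k. x k u"] by (meson not_le)
    have "g v \<le> g u"
      by (rule exchange[OF k(1) that(2,1)])
        (use gt k that bounds(1)[OF k(1) that(1)] bounds(2)[OF k(1) that(2)] in auto)
    with gt show False by simp
  qed
  have tight: "(\<Sum>\<tau>=1..t. x k \<tau>) = M k t"
    if t: "1 \<le> t" "t < T" and drop: "g (Suc t) < g t" and k: "k \<in> K" for t k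
  proof (rule ccontr)
    define L where "L = (\<lambda>t. (\<Sum>\<tau>=1..t. x k \<tau>) - M k t)"
    assume "(\<Sum>\<tau>=1..t. x k \<tau>) \<noteq> M k t"
    then have Lt: "0 < L t" using bounds(3)[OF k, of t] t by (simp add: L_def)
    have L0: "L 0 = 0" and LT: "L T = 0" using M0 total k by (simp_all add: L_def)
    have L_step: "L s - L (s - 1) = x k s - (M k s - M k (s - 1))" if "s \<in> {1..T}" for s
      using that by (cases s) (auto simp: L_def)
    \<comment> \<open>The surplus of bus k at t was built up at some u and is used up at some v, so a bit of
      its supply can be postponed from u to v.\<close>
    have ex_u: "\<exists>u. u \<in> {1..t} \<and> 0 < x k u \<and> (\<forall>s. u \<le> s \<and> s \<le> t \<longrightarrow> 0 < L s)"
    proof -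
      \<comment> \<open>The last time up to \<open>t\<close> without surplus, which exists because
        \<open>L 0 = 0\<close>. The surplus rises in period \<open>Suc z\<close>, so the supply
        there exceeds a nonnegative increment of \<open>M k\<close>.\<close>
      define z where "z = Max {s. s \<le> t \<and> L s \<le> 0}"
      have fin: "finite {s. s \<le> t \<and> L s \<le> 0}" by simp
      have ne: "{s. s \<le> t \<and> L s \<le> 0} \<noteq> {}" using L0 by force
      have z: "z \<le> t" "L z \<le> 0" using Max_in[OF fin ne] by (auto simp: z_def)
      have "s \<le> z" if "s \<le> t" "L s \<le> 0" for s
        unfolding z_def by (rule Max_ge[OF fin]) (use that in simp)
      then have above: "0 < L s" if "z < s" "s \<le> t" for s
        using that by force
      have "z < t" using z Lt by (cases "z = t") auto
      have "0 < x k (Suc z)"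
        using L_step[of "Suc z"] above[of "Suc z"] z \<open>z < t\<close> t step(1)[OF k, of "Suc z"] by auto
      then show ?thesis using above \<open>z < t\<close> by (intro exI[of _ "Suc z"]) auto
    qed
    have ex_v: "\<exists>v. v \<in> {Suc t..T} \<and> x k v < f k \<and> (\<forall>s. t \<le> s \<and> s < v \<longrightarrow> 0 < L s)"
    proof -
      \<comment> \<open>The first time from \<open>t\<close> on without surplus, which exists
        because \<open>L T = 0\<close>. The surplus falls in period \<open>v\<close>, so the supply
        there is below an increment of \<open>M k\<close>, hence below \<open>f k\<close>.\<close>
      define v where "v = (LEAST s. t \<le> s \<and> L s \<le> 0)"
      have P: "t \<le> T \<and> L T \<le> 0" using LT t by simp
      have v: "t \<le> v" "L v \<le> 0" using LeastI[of "\<lambda>s. t \<le> s \<and> L s \<le> 0", OF P] by (auto simp: v_def)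
      have "v \<le> T" unfolding v_def by (rule Least_le) (use P in simp)
      have below: "0 < L s" if "t \<le> s" "s < v" for s
        using not_less_Least[of s "\<lambda>s. t \<le> s \<and> L s \<le> 0"] that by (force simp: v_def)
      have "t < v" using v Lt by (cases "v = t") auto
      have "0 < L (v - 1)" by (rule below) (use \<open>t < v\<close> in auto)
      then have "x k v < f k"
        using L_step[of v] v \<open>t < v\<close> \<open>v \<le> T\<close> step(2)[OF k, of v] by auto
      then show ?thesis using below \<open>t < v\<close> \<open>v \<le> T\<close> by (intro exI[of _ v]) auto
    qed
    obtain u where u: "u \<in> {1..t}" "0 < x k u" "\<And>s. u \<le> s \<Longrightarrow> s \<le> t \<Longrightarrow> 0 < L s"
      using ex_u by blast
    obtain v where v: "v \<in> {Suc t..T}" "x k v < f k" "\<And>s. t \<le> s \<Longrightarrow> s < v \<Longrightarrow> 0 < L s"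
      using ex_v by blast
    have L_pos: "0 < L s" if "u \<le> s" "s < v" for s
      using u(3)[of s] v(3)[of s] that by (cases "s \<le> t") auto
    have "g u \<le> g v"
      by (rule exchange[OF k]) (use u v t L_pos in \<open>auto simp: L_def\<close>)
    \<comment> \<open>The chain from \<open>g t\<close> over \<open>g u\<close> and
      \<open>g v\<close> up to \<open>g (Suc t)\<close> contradicts the drop.\<close>
    moreover have "g t \<le> g u" by (rule decr) (use u t in auto)
    moreover have "g v \<le> g (Suc t)" by (rule decr) (use v t in auto)
    ultimately show False using drop by simp
  qed
  show ?thesis
    by (intro bexI[OF _ x]) (use decr tight in \<open>auto simp: g_def\<close>)
qed

section \<open>The star network: feasibility and the least budget\<close>

locale star_network =
  fixes n T :: nat
    and f :: "nat \<Rightarrow> real"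
    and d :: "nat \<Rightarrow> nat \<Rightarrow> real"
  assumes buses: "2 \<le> n"
    and horizon: "1 \<le> T"
    and line_nonneg: "k \<in> {2..n} \<Longrightarrow> 0 \<le> f k"
    and demand_nonneg: "k \<in> {2..n} \<Longrightarrow> t \<in> {1..T} \<Longrightarrow> 0 \<le> d k t"
    and mean_demand_le: "k \<in> {2..n} \<Longrightarrow> t \<in> {1..T} \<Longrightarrow> (\<Sum>\<tau>=1..t. d k \<tau>) \<le> real t * f k"
begin

text \<open>The instance of the bound \<open>M\<close> in \<open>schedules\<close>: cumulative
  supply stays above it exactly when the storage at bus \<open>k\<close> stays above its least
  trajectory.\<close>

definition least_supply :: "nat \<Rightarrow> nat \<Rightarrow> real" where
  "least_supply k t = (\<Sum>\<tau>=1..t. d k \<tau>) + min_level T (f k) (d k) t"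

definition h_min :: real where
  "h_min = (\<Sum>k=2..n. min_capacity T (f k) (d k))"

lemma h_min_nonneg: "0 \<le> h_min"
  unfolding h_min_def by (intro sum_nonneg min_capacity_nonneg horizon)

lemma least_supply_final: "least_supply k T = (\<Sum>\<tau>=1..T. d k \<tau>)"
  by (simp add: least_supply_def min_level_final)

lemma least_supply_initial: "k \<in> {2..n} \<Longrightarrow> least_supply k 0 = 0"
  using min_level_initial[of T "d k" "f k"] mean_demand_le by (simp add: least_supply_def)

lemma least_supply_step:
  assumes "k \<in> {2..n}" "t \<in> {1..T}"
  shows "0 \<le> least_supply k t - least_supply k (t - 1)"
    and "least_supply k t - least_supply k (t - 1) \<le> f k"
proof -
  have "(\<Sum>\<tau>=1..t. d k \<tau>) = d k t + (\<Sum>\<tau>=1..t - 1. d k \<tau>)"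
    using assms by (cases t) auto
  then show "0 \<le> least_supply k t - least_supply k (t - 1)"
    and "least_supply k t - least_supply k (t - 1) \<le> f k"
    using min_level_step_ge[where d = "d k", OF assms(2) line_nonneg demand_nonneg, OF assms(1) assms]
      min_level_step_le[OF assms(2), of "d k" "f k"]
    by (simp_all add: least_supply_def)
qed

lemma least_supply_schedule:
  "(\<lambda>k t. least_supply k t - least_supply k (t - 1)) \<in> schedules {2..n} T f least_supply"
  unfolding schedules_def
  using least_supply_step least_supply_initial sum_diff_telescope[of "least_supply _"] by simp

lemma sum_buses: "(\<Sum>k=1..n. F k) = F 1 + (\<Sum>k=2..n. F k :: real)"
  using buses by (simp add: sum.atLeast_Suc_atMost numeral_2_eq_2)

text \<open>The level at a load bus is cumulative supply minus cumulative demand. It is nonnegative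
  because \<open>least_supply\<close> is at least the cumulative demand, and it ends at 0 because
  the two agree at \<open>T\<close>.\<close>

lemma schedule_feasible:
  assumes x: "x \<in> schedules {2..n} T f least_supply"
    and b: "\<And>k t. k \<in> {2..n} \<Longrightarrow> t \<in> {1..T} \<Longrightarrow>
              (\<Sum>\<tau>=1..t. x k \<tau>) - (\<Sum>\<tau>=1..t. d k \<tau>) \<le> b k"
    and budget: "(\<Sum>k=2..n. b k) \<le> h"
  shows "feasible_Pi n T f d h (\<lambda>t. \<Sum>k=2..n. x k t)
           (\<lambda>k t. if k = 1 then 0 else x k t - d k t) x (\<lambda>k. if k = 1 then 0 else b k)"
    (is "feasible_Pi _ _ _ _ _ ?g ?r _ ?b")
proof -
  have lev: "storage_level ?r k t =
      (if k = 1 then 0 else (\<Sum>\<tau>=1..t. x k \<tau>) - (\<Sum>\<tau>=1..t. d k \<tau>))" for k t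
    by (simp add: storage_level_def sum_subtractf)
  have load: "k \<in> {2..n}" if "k \<in> {1..n}" "k \<noteq> 1" for k
    using that by auto
  have bounds: "0 \<le> x k t" "x k t \<le> f k" "least_supply k t \<le> (\<Sum>\<tau>=1..t. x k \<tau>)"
    if "k \<in> {2..n}" "t \<in> {1..T}" for k t
    using x that by (auto simp: schedules_def)
  have level_nonneg: "0 \<le> (\<Sum>\<tau>=1..t. x k \<tau>) - (\<Sum>\<tau>=1..t. d k \<tau>)"
    if "k \<in> {2..n}" "t \<in> {1..T}" for k t
    using bounds(3)[OF that] min_level_nonneg[of t T "f k" "d k"] that
    by (simp add: least_supply_def)
  have final: "(\<Sum>\<tau>=1..T. x k \<tau>) - (\<Sum>\<tau>=1..T. d k \<tau>) = 0" if "k \<in> {2..n}" for k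
    using x that by (simp add: schedules_def least_supply_final)
  \<comment> \<open>\<open>b\<close> is only assumed to bound the levels; the level at
    \<open>T\<close> is 0, which gives the sign.\<close>
  have b_nonneg: "0 \<le> b k" if "k \<in> {2..n}" for k
    using b[OF that, of T] final[OF that] horizon by simp
  have "(\<Sum>k=2..n. ?b k) = (\<Sum>k=2..n. b k)" by (intro sum.cong) auto
  then have "(\<Sum>k=1..n. ?b k) \<le> h"
    using budget by (simp only: sum_buses) simp
  moreover have "0 \<le> ?g t" if "t \<in> {1..T}" for t
    using bounds(1) that by (intro sum_nonneg) auto
  moreover have "x k t = d k t + ?r k t \<and> \<bar>x k t\<bar> \<le> f k" if "k \<in> {2..n}" "t \<in> {1..T}" for k t
    using bounds(1,2)[OF that] that by auto
  moreover have "0 \<le> storage_level ?r k t \<and> storage_level ?r k t \<le> ?b k"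
    if "k \<in> {1..n}" "t \<in> {1..T}" for k t
    using level_nonneg[OF load _, of k t] b[OF load _, of k t] that unfolding lev by auto
  moreover have "storage_level ?r k T = 0 \<and> 0 \<le> ?b k" if "k \<in> {1..n}" for k
    using final[OF load, of k] b_nonneg[OF load, of k] that unfolding lev by auto
  ultimately show ?thesis
    unfolding feasible_Pi_def feasible_P_def by simp
qed

lemma feasible_storage_ge:
  assumes "feasible_P n T f d h g r p b" "k \<in> {2..n}" "t \<le> T"
  shows "min_level T (f k) (d k) t \<le> (\<Sum>\<tau>=1..t. r k \<tau>)"
proof (rule min_level_le_storage[OF assms(3)])
  fix u assume "u \<le> T"
  then show "0 \<le> (\<Sum>\<tau>=1..u. r k \<tau>)"
    using assms(1,2) by (cases "u = 0") (auto simp: feasible_P_def storage_level_def)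
next
  fix \<tau> assume "\<tau> \<in> {1..T}"
  then have "p k \<tau> = d k \<tau> + r k \<tau>" "\<bar>p k \<tau>\<bar> \<le> f k"
    using assms(1,2) unfolding feasible_P_def by blast+
  then show "d k \<tau> + r k \<tau> \<le> f k" by simp
qed

lemma feasible_capacity_ge:
  assumes "feasible_P n T f d h g r p b" "k \<in> {2..n}"
  shows "min_capacity T (f k) (d k) \<le> b k"
proof (rule min_capacity_le[OF horizon])
  show b0: "0 \<le> b k" using assms by (auto simp: feasible_P_def)
  fix t assume t: "t \<le> T"
  then have "(\<Sum>\<tau>=1..t. r k \<tau>) \<le> b k"
    using assms b0 by (cases "t = 0") (auto simp: feasible_P_def storage_level_def)
  then show "min_level T (f k) (d k) t \<le> b k"
    using feasible_storage_ge[OF assms t] by simp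
qed

text \<open>Keeping \<open>b 1\<close> in the bound serves twice: it makes \<open>h_min\<close>
  necessary, and at \<open>h = h_min\<close> it leaves no budget for bus 1.\<close>

lemma feasible_budget_ge:
  assumes "feasible_P n T f d h g r p b"
  shows "b 1 + h_min \<le> h"
proof -
  have "h_min \<le> (\<Sum>k=2..n. b k)"
    unfolding h_min_def by (intro sum_mono feasible_capacity_ge[OF assms])
  moreover have "(\<Sum>k=1..n. b k) \<le> h" using assms by (simp add: feasible_P_def)
  ultimately show ?thesis by (simp only: sum_buses)
qed

lemma feasible_P_h_min_iff: "feasible_P n T f d h_min g r p b \<longleftrightarrow> feasible_Pi n T f d h_min g r p b"
proof -
  have "b 1 = 0" if "feasible_P n T f d h_min g r p b"
  proof (rule antisym)
    show "b 1 \<le> 0" using feasible_budget_ge[OF that] by simp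
    show "0 \<le> b 1" using that buses by (auto simp: feasible_P_def)
  qed
  then show ?thesis by (auto simp: feasible_Pi_def)
qed

text \<open>Summing the power balance, cumulative generation is demand plus the energy stored at all
  buses. Storage at bus 1 can only add to it, and at \<open>T\<close> every storage is
  empty.\<close>

lemma feasible_supply:
  assumes "feasible_P n T f d h g r p b" "t \<in> {1..T}"
  shows "(\<Sum>k=2..n. least_supply k t) \<le> (\<Sum>\<tau>=1..t. g \<tau>)"
    and "(\<Sum>\<tau>=1..T. g \<tau>) = (\<Sum>k=2..n. least_supply k T)"
proof -
  have gen: "(\<Sum>\<tau>=1..s. g \<tau>) =
      (\<Sum>\<tau>=1..s. r 1 \<tau>) + (\<Sum>k=2..n. (\<Sum>\<tau>=1..s. d k \<tau>) + (\<Sum>\<tau>=1..s. r k \<tau>))"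
    if "s \<le> T" for s
  proof -
    have "(\<Sum>\<tau>=1..s. g \<tau>) = (\<Sum>\<tau>=1..s. r 1 \<tau> + (\<Sum>k=2..n. d k \<tau> + r k \<tau>))"
    proof (rule sum.cong[OF refl])
      fix \<tau> assume "\<tau> \<in> {1..s}"
      then have "g \<tau> - r 1 \<tau> = (\<Sum>k=2..n. p k \<tau>)" "\<forall>k\<in>{2..n}. p k \<tau> = d k \<tau> + r k \<tau>"
        using assms(1) that by (auto simp: feasible_P_def)
      then show "g \<tau> = r 1 \<tau> + (\<Sum>k=2..n. d k \<tau> + r k \<tau>)" by simp
    qed
    then show ?thesis
      by (simp add: sum.distrib sum.swap[of _ "{2..n}" "{Suc 0..s}"])
  qed
  have "0 \<le> (\<Sum>\<tau>=1..t. r 1 \<tau>)"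
    using assms buses by (auto simp: feasible_P_def storage_level_def)
  moreover have "(\<Sum>k=2..n. least_supply k t)
      \<le> (\<Sum>k=2..n. (\<Sum>\<tau>=1..t. d k \<tau>) + (\<Sum>\<tau>=1..t. r k \<tau>))"
    unfolding least_supply_def
    using feasible_storage_ge[OF assms(1), of _ t] assms(2) by (intro sum_mono add_left_mono) auto
  ultimately show "(\<Sum>k=2..n. least_supply k t) \<le> (\<Sum>\<tau>=1..t. g \<tau>)"
    using gen[of t] assms(2) by simp
  have "(\<Sum>\<tau>=1..T. r k \<tau>) = 0" if "k \<in> {1..n}" for k
    using assms(1) that by (auto simp: feasible_P_def storage_level_def)
  then show "(\<Sum>\<tau>=1..T. g \<tau>) = (\<Sum>k=2..n. least_supply k T)"
    using gen[of T] buses by (simp add: least_supply_final)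
qed

lemma Pi_feasible_if: "h_min \<le> h \<Longrightarrow> Pi_feasible n T f d h"
proof -
  assume "h_min \<le> h"
  \<comment> \<open>Flows along the least trajectory: the levels telescope to
    \<open>min_level\<close>, which stays below \<open>min_capacity\<close>.\<close>
  let ?x = "\<lambda>k t. least_supply k t - least_supply k (t - 1)"
  have "(\<Sum>\<tau>=1..t. ?x k \<tau>) - (\<Sum>\<tau>=1..t. d k \<tau>) \<le> min_capacity T (f k) (d k)"
    if "k \<in> {2..n}" "t \<in> {1..T}" for k t
    using min_level_le_min_capacity[of t T "f k" "d k"] horizon that
      sum_diff_telescope[of "least_supply k" t] least_supply_initial[OF that(1)]
    by (simp add: least_supply_def)
  from schedule_feasible[OF least_supply_schedule this]
  show ?thesis
    using \<open>h_min \<le> h\<close> unfolding Pi_feasible_def h_min_def by blast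
qed

lemma P_feasible_only_if: "P_feasible n T f d h \<Longrightarrow> h_min \<le> h"
proof -
  assume "P_feasible n T f d h"
  then obtain g r p b where F: "feasible_P n T f d h g r p b" by (auto simp: P_feasible_def)
  then have "0 \<le> b 1" using buses by (auto simp: feasible_P_def)
  then show ?thesis using feasible_budget_ge[OF F] by simp
qed

section \<open>Equality of the optimal values for large budgets\<close>

lemma p_opt_le_pi_opt: "p_opt n T f d c h \<le> pi_opt n T f d c h"
  unfolding p_opt_def pi_opt_def by (rule Inf_superset_mono) (auto simp: feasible_Pi_def)

lemma p_opt_eq_pi_opt_saturated:
  assumes "convex_on {0..} c" "mono_on {0..} c"
    and h: "(\<Sum>k=2..n. \<Sum>\<tau>=1..T. d k \<tau>) \<le> h"
  shows "p_opt n T f d c h = pi_opt n T f d c h"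
proof (rule antisym[OF p_opt_le_pi_opt])
  obtain x where x: "x \<in> schedules {2..n} T f least_supply"
    and decr: "\<And>t. 1 \<le> t \<Longrightarrow> t < T \<Longrightarrow> (\<Sum>k=2..n. x k (Suc t)) \<le> (\<Sum>k=2..n. x k t)"
    and tight: "\<And>t k. 1 \<le> t \<Longrightarrow> t < T \<Longrightarrow> (\<Sum>k=2..n. x k (Suc t)) < (\<Sum>k=2..n. x k t) \<Longrightarrow>
                  k \<in> {2..n} \<Longrightarrow> (\<Sum>\<tau>=1..t. x k \<tau>) = least_supply k t"
    using front_loaded_schedule_exists[of "{2..n}" least_supply T f]
      least_supply_initial least_supply_step by (metis finite_atLeastAtMost)
  let ?g = "\<lambda>t. \<Sum>k=2..n. x k t"
  have x_nonneg: "0 \<le> x k t" if "k \<in> {2..n}" "t \<in> {1..T}" for k t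
    using x that by (auto simp: schedules_def)
  have x_total: "(\<Sum>\<tau>=1..T. x k \<tau>) = (\<Sum>\<tau>=1..T. d k \<tau>)" if "k \<in> {2..n}" for k
    using x that by (simp add: schedules_def least_supply_final)
  \<comment> \<open>Nothing beyond its total demand is ever sent to bus \<open>k\<close>, so a
    capacity of that size holds whatever is stored there.\<close>
  have "(\<Sum>\<tau>=1..t. x k \<tau>) - (\<Sum>\<tau>=1..t. d k \<tau>) \<le> (\<Sum>\<tau>=1..T. d k \<tau>)"
    if k: "k \<in> {2..n}" and t: "t \<in> {1..T}" for k t
  proof -
    have "(\<Sum>\<tau>=1..t. x k \<tau>) \<le> (\<Sum>\<tau>=1..T. x k \<tau>)"
      using x_nonneg[OF k] t by (intro sum_mono2) auto
    moreover have "0 \<le> (\<Sum>\<tau>=1..t. d k \<tau>)"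
      using demand_nonneg[OF k] t by (intro sum_nonneg) auto
    ultimately show ?thesis using x_total[OF k] by simp
  qed
  from schedule_feasible[OF x this h]
  have "pi_opt n T f d c h \<le> ereal (cost T c ?g)"
    unfolding pi_opt_def by (intro Inf_lower) blast
  also have "\<dots> \<le> p_opt n T f d c h"
    unfolding p_opt_def
  proof (rule Inf_greatest, clarify)
    fix g r p b assume F: "feasible_P n T f d h g r p b"
    have "(\<Sum>t=1..T. c (?g t)) \<le> (\<Sum>t=1..T. c (g t))"
    proof (rule front_loaded_cost_le[OF horizon assms(1,2)])
      show "0 \<le> ?g t" if "t \<in> {1..T}" for t
        using x_nonneg that by (intro sum_nonneg) auto
      show "0 \<le> g t" if "t \<in> {1..T}" for t
        using F that by (auto simp: feasible_P_def)
      \<comment> \<open>At a drop \<open>x\<close> is at \<open>least_supply\<close> on every bus,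
        and no feasible point can have generated less by then, even with storage at bus 1.\<close>
      show "(\<Sum>\<tau>=1..t. ?g \<tau>) \<le> (\<Sum>\<tau>=1..t. g \<tau>)"
        if "1 \<le> t" "t < T" "?g (Suc t) < ?g t" for t
        using feasible_supply(1)[OF F, of t] tight[OF that] that
        by (simp add: sum.swap[of _ "{2..n}" "{Suc 0..t}"])
      show "(\<Sum>\<tau>=1..T. ?g \<tau>) = (\<Sum>\<tau>=1..T. g \<tau>)"
        using feasible_supply(2)[OF F, of T] horizon x_total
        by (simp add: sum.swap[of _ "{2..n}" "{Suc 0..T}"] least_supply_final)
    qed (fact decr)
    then show "ereal (cost T c ?g) \<le> ereal (cost T c g)" by (simp add: cost_def)
  qed
  finally show "pi_opt n T f d c h \<le> p_opt n T f d c h" .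
qed

end

section \<open>From the stated hypotheses to the result\<close>

lemma strictly_convex_imp_convex:
  assumes "strictly_convex_on S c"
  shows "convex_on S c"
proof (rule convex_onI)
  fix u x y assume u: "0 < u" "u < (1::real)" and xy: "x \<in> S" "y \<in> S"
  show "c ((1 - u) *\<^sub>R x + u *\<^sub>R y) \<le> (1 - u) * c x + u * c y"
  proof (cases "x = y")
    case True
    then show ?thesis by (simp add: algebra_simps)
  next
    case False
    then have "c ((1 - u) * x + u * y) < (1 - u) * c x + u * c y"
      using assms u xy unfolding strictly_convex_on_def by blast
    then show ?thesis by simp
  qed
qed (use assms in \<open>simp add: strictly_convex_on_def\<close>)

theorem proposition4:
  fixes n T :: nat
    and f :: "nat \<Rightarrow> real"
    and d :: "nat \<Rightarrow> nat \<Rightarrow> real"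
    and c :: "real \<Rightarrow> real"
  assumes "2 \<le> n" and "1 \<le> T"
    and "\<And>k. k \<in> {2..n} \<Longrightarrow> 0 \<le> f k"
    and "\<And>k t. k \<in> {2..n} \<Longrightarrow> t \<in> {1..T} \<Longrightarrow> 0 \<le> d k t"
    and "\<And>x. 0 \<le> x \<Longrightarrow> 0 \<le> c x"
    and "mono_on {0..} c"
    and "strictly_convex_on {0..} c"
    and "\<And>k. k \<in> {2..n} \<Longrightarrow> f k \<ge> (MAX t\<in>{1..T}. (\<Sum>\<tau>=1..t. d k \<tau>) / real t)"
  shows "\<exists>h_min\<ge>0.
    h_min = (\<Sum>k=2..n. Max {max (\<Sum>\<tau>=t\<^sub>1+1..t\<^sub>2. d k \<tau> - f k) 0 | t\<^sub>1 t\<^sub>2. t\<^sub>1 < t\<^sub>2 \<and> t\<^sub>2 \<le> T}) \<and>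
    (\<forall>h\<ge>0. P_feasible n T f d h \<longleftrightarrow> h \<ge> h_min) \<and>
    (\<forall>h\<ge>0. Pi_feasible n T f d h \<longleftrightarrow> h \<ge> h_min) \<and>
    p_opt n T f d c h_min = pi_opt n T f d c h_min \<and>
    (\<exists>h_sat\<ge>h_min. \<forall>h\<ge>h_sat. p_opt n T f d c h = pi_opt n T f d c h)"
proof -
  interpret star_network n T f d
  proof
    fix k t assume k: "k \<in> {2..n}" and t: "t \<in> {1..T}"
    have "(\<Sum>\<tau>=1..t. d k \<tau>) / real t \<le> (MAX t\<in>{1..T}. (\<Sum>\<tau>=1..t. d k \<tau>) / real t)"
      using t by (intro Max_ge) auto
    also have "\<dots> \<le> f k" by (rule assms(8)[OF k])
    finally show "(\<Sum>\<tau>=1..t. d k \<tau>) \<le> real t * f k"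
      using t by (simp add: field_simps)
  qed (use assms in auto)
  let ?D = "\<Sum>k=2..n. \<Sum>\<tau>=1..T. d k \<tau>"
  have P_if_Pi: "P_feasible n T f d h" if "Pi_feasible n T f d h" for h
    using that by (auto simp: P_feasible_def Pi_feasible_def feasible_Pi_def)
  have "p_opt n T f d c h_min = pi_opt n T f d c h_min"
    by (simp add: p_opt_def pi_opt_def feasible_P_h_min_iff)
  moreover have "\<exists>h_sat\<ge>h_min. \<forall>h\<ge>h_sat. p_opt n T f d c h = pi_opt n T f d c h"
    using p_opt_eq_pi_opt_saturated[OF strictly_convex_imp_convex[OF assms(7)] assms(6)]
    \<comment> \<open>A budget of \<open>?D\<close>, the total demand, suffices for the equality;
      the maximum gives \<open>h_sat \<ge> h_min\<close> at once.\<close>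
    by (intro exI[of _ "max h_min ?D"]) simp
  moreover have "P_feasible n T f d h \<longleftrightarrow> h_min \<le> h" "Pi_feasible n T f d h \<longleftrightarrow> h_min \<le> h" for h
    using Pi_feasible_if P_feasible_only_if P_if_Pi by blast+
  ultimately show ?thesis
    using h_min_nonneg h_min_def[unfolded min_capacity_def] by blast
qed

end
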